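(* Let $(A,\mu,\alpha)$ be a Hom-commutative algebra over $\mathbf{k}$ and let $D \colon A \to A$ be a derivation such that $D\alpha = \alpha D$. Define a new product on $A$ by $$a \ast b = \mu(a,D(b)) = aD(b) \qquad (a,b \in A).$$ Then $(A,\ast,\alpha)$ is a Hom-Novikov algebra.
   Context: Throughout, $\mathbf{k}$ is a ground field of characteristic $0$; vector spaces and (bi)linear maps are over $\mathbf{k}$. Given a bilinear multiplication $\mu \colon A^{\otimes 2} \to A$, write $xy$ for $\mu(x,y)$. A Hom-associative algebra is a triple $(A,\mu,\alpha)$ consisting of a vector space $A$, a linear map $\alpha \colon A \to A$ and a bilinear map $\mu \colon A^{\otimes 2} \to A$ such that for all $x,y,z\in A$: $\alpha(xy) = \alpha(x)\alpha(y)$ (multiplicativity) and $(xy)\alpha(z) = \alpha(x)(yz)$ (Hom-associativity). A Hom-commutative algebra is a Hom-associative algebra whose multiplication is commutative, i.e. $xy=yx$ for all $x,y$. A derivation on $(A,\mu,\alpha)$ is a linear map $D \colon A \to A$ with $D(xy) = D(x)y + xD(y)$ for all $x,y\in A$. A Hom-Novikov algebra is a triple $(A,\mu,\alpha)$ where $A$ is a vector space, $\mu \colon A^{\otimes 2} \to A$ is a bilinear map (written $xy=\mu(x,y)$) and $\alpha \colon A \to A$ is a linear map, such that for all $x,y,z \in A$: (i) $\alpha(xy) = \alpha(x)\alpha(y)$; (ii) $(xy)\alpha(z) - \alpha(x)(yz) = (yx)\alpha(z) - \alpha(y)(xz)$; (iii) $(xy)\alpha(z) = (xz)\alpha(y)$.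 *)

theory Defs
  imports Complex_Main
begin

text \<open>
  The ground field is a type \<open>'k\<close> of class \<open>field_char_0\<close>; the underlying vector space is a whole
  type \<open>'a\<close> with scalar multiplication \<open>scale\<close>.  A bilinear map \<open>A \<otimes> A \<rightarrow> A\<close> is rendered as a
  curried function that is linear in each argument.

  The three kinds of algebra below share the part collected in \<open>multiplicative_hom_algebra\<close>.
\<close>

locale multiplicative_hom_algebra = vector_space scale
  for scale :: "'k::field_char_0 \<Rightarrow> 'a::ab_group_add \<Rightarrow> 'a" +
  fixes \<mu> :: "'a \<Rightarrow> 'a \<Rightarrow> 'a"
    and \<alpha> :: "'a \<Rightarrow> 'a"
  assumes linear_mult_right: "Vector_Spaces.linear scale scale (\<lambda>y. \<mu> x y)"
    and linear_mult_left: "Vector_Spaces.linear scale scale (\<lambda>x. \<mu> x y)"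
    and linear_twist: "Vector_Spaces.linear scale scale \<alpha>"
    and twist_mult: "\<alpha> (\<mu> x y) = \<mu> (\<alpha> x) (\<alpha> y)"

locale hom_associative_algebra = multiplicative_hom_algebra +
  assumes hom_assoc: "\<mu> (\<mu> x y) (\<alpha> z) = \<mu> (\<alpha> x) (\<mu> y z)"

locale hom_commutative_algebra = hom_associative_algebra +
  assumes mult_commute: "\<mu> x y = \<mu> y x"

locale hom_derivation = hom_associative_algebra scale \<mu> \<alpha>
  for scale :: "'k::field_char_0 \<Rightarrow> 'a::ab_group_add \<Rightarrow> 'a"
    and \<mu> :: "'a \<Rightarrow> 'a \<Rightarrow> 'a"
    and \<alpha> :: "'a \<Rightarrow> 'a" +
  fixes D :: "'a \<Rightarrow> 'a"
  assumes linear_derivation: "Vector_Spaces.linear scale scale D"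
    and leibniz: "D (\<mu> x y) = \<mu> (D x) y + \<mu> x (D y)"

locale hom_novikov_algebra = multiplicative_hom_algebra +
  assumes hom_left_symmetric:
      "\<mu> (\<mu> x y) (\<alpha> z) - \<mu> (\<alpha> x) (\<mu> y z) = \<mu> (\<mu> y x) (\<alpha> z) - \<mu> (\<alpha> y) (\<mu> x z)"
    and hom_right_commute: "\<mu> (\<mu> x y) (\<alpha> z) = \<mu> (\<mu> x z) (\<alpha> y)"

end

(*
  Since D commutes with the twist, (x * y) * alpha(z) = alpha(x) (D(y) D(z)), which is symmetric
  in y and z.  The Leibniz rule then leaves - alpha(x) (y D(D(z))) = - (x y) alpha(D(D(z))) as the
  Hom-associator of *, which is symmetric in x and y.
*)
theory Submission
  imports Defs
begin

theorem theorem1p2: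
  fixes scale :: "'k::field_char_0 \<Rightarrow> 'a::ab_group_add \<Rightarrow> 'a"
    and \<mu> :: "'a \<Rightarrow> 'a \<Rightarrow> 'a"
    and \<alpha> D :: "'a \<Rightarrow> 'a"
  assumes "hom_commutative_algebra scale \<mu> \<alpha>"
    and "hom_derivation scale \<mu> \<alpha> D"
    and "D \<circ> \<alpha> = \<alpha> \<circ> D"
  shows "hom_novikov_algebra scale (\<lambda>a b. \<mu> a (D b)) \<alpha>"
proof -
  interpret hom_commutative_algebra scale \<mu> \<alpha> by fact
  interpret hom_derivation scale \<mu> \<alpha> D by fact
  have D_twist: "D (\<alpha> x) = \<alpha> (D x)" for x
    using assms(3) by (metis comp_apply)
  have mult_add: "\<mu> x (y + z) = \<mu> x y + \<mu> x z" for x y z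
    using linear_mult_right by (simp add: Vector_Spaces.linear_iff)
  \<comment> \<open>Once \<open>D\<close> is moved inside the twist, this is
    \<open>hom_assoc\<close> at \<open>x\<close>, \<open>D y\<close>, \<open>D z\<close>.\<close>
  have product: "\<mu> (\<mu> x (D y)) (D (\<alpha> z)) = \<mu> (\<alpha> x) (\<mu> (D y) (D z))" for x y z
    by (simp add: D_twist hom_assoc)
  have associator: "\<mu> (\<mu> x (D y)) (D (\<alpha> z)) - \<mu> (\<alpha> x) (D (\<mu> y (D z)))
      = - \<mu> (\<mu> x y) (\<alpha> (D (D z)))" for x y z
    \<comment> \<open>The summand with \<open>\<mu> (D y) (D z)\<close> cancels. Since
      \<open>hom_assoc\<close> rewrites from left to right, both sides meet at
      \<open>- \<mu> (\<alpha> x) (\<mu> y (D (D z)))\<close>.\<close>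
    by (simp add: product leibniz mult_add hom_assoc)
  show ?thesis
  proof (intro hom_novikov_algebra.intro multiplicative_hom_algebra.intro
      multiplicative_hom_algebra_axioms.intro hom_novikov_algebra_axioms.intro)
    show "vector_space scale"
      by (rule vector_space_axioms)
    show "Vector_Spaces.linear scale scale (\<lambda>y. \<mu> x (D y))" for x
      \<comment> \<open>In its second argument the new product is \<open>D\<close> followed by left
        multiplication by \<open>x\<close>.\<close>
      using Vector_Spaces.linear_compose[OF linear_derivation linear_mult_right] by (simp add: o_def)
    show "Vector_Spaces.linear scale scale (\<lambda>x. \<mu> x (D y))" for y
      by (rule linear_mult_left)
    show "Vector_Spaces.linear scale scale \<alpha>"
      by (rule linear_twist)
    show "\<alpha> (\<mu> x (D y)) = \<mu> (\<alpha> x) (D (\<alpha> y))" for x y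
      by (simp add: twist_mult D_twist)
    show "\<mu> (\<mu> x (D y)) (D (\<alpha> z)) - \<mu> (\<alpha> x) (D (\<mu> y (D z)))
        = \<mu> (\<mu> y (D x)) (D (\<alpha> z)) - \<mu> (\<alpha> y) (D (\<mu> x (D z)))" for x y z
      \<comment> \<open>The sides now differ only in the order of \<open>x\<close> and
        \<open>y\<close> in the inner product; fixing this instance of commutativity makes it a
        one-way rewrite.\<close>
      unfolding associator by (simp only: mult_commute[of x y])
    show "\<mu> (\<mu> x (D y)) (D (\<alpha> z)) = \<mu> (\<mu> x (D z)) (D (\<alpha> y))" for x y z
      unfolding product by (simp only: mult_commute[of "D y" "D z"])
  qed
qed

end
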